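(* Let $G$ be a locally compact $\sigma$-compact (Hausdorff) group and let $H$ be an amenable discrete subgroup of $G$. If $\alpha = \sum_{h\in H} a_h h$ is a non-zerodivisor in the group ring $\mathbb{C}H$, then $\alpha \ast f := \sum_h a_h L_h f \neq 0$ for every nonzero $f \in L^2(G)$.
   Context: $L^2(G)$ is with respect to left Haar measure and $L_h f(x) = f(h^{-1}x)$. A non-zerodivisor in $\mathbb{C}H$ is an element $\alpha$ with $\alpha\beta\neq0$ and $\beta\alpha\neq 0$ for all nonzero $\beta\in\mathbb{C}H$. *)

theory Defs
  imports "HOL-Analysis.Analysis"
begin

text \<open>The (not necessarily commutative) group G is the carrier type 'g of class group_add,
  written additively: the group product g h is g + h, the inverse of h is - h, the unit is 0.\<close>

definition topological_group_type :: "'g::{group_add, topological_space} itself \<Rightarrow> bool" where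
  "topological_group_type _ \<longleftrightarrow>
     continuous_on UNIV (\<lambda>p::'g \<times> 'g. fst p + snd p) \<and> continuous_on UNIV (\<lambda>x::'g. - x)"

definition locally_compact_type :: "'g::topological_space itself \<Rightarrow> bool" where
  "locally_compact_type _ \<longleftrightarrow>
     (\<forall>x::'g. \<exists>U K. open U \<and> compact K \<and> x \<in> U \<and> U \<subseteq> K)"

definition sigma_compact_type :: "'g::topological_space itself \<Rightarrow> bool" where
  "sigma_compact_type _ \<longleftrightarrow>
     (\<exists>K :: nat \<Rightarrow> 'g set. (\<forall>n. compact (K n)) \<and> (\<Union>n. K n) = UNIV)"

definition left_haar_measure :: "'g::{group_add, topological_space} measure \<Rightarrow> bool" where
  "left_haar_measure \<mu> \<longleftrightarrow>
     sets \<mu> = sets borel \<and> space \<mu> = UNIV \<and>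
     (\<forall>g A. A \<in> sets borel \<longrightarrow> emeasure \<mu> ((\<lambda>x. g + x) ` A) = emeasure \<mu> A) \<and>
     (\<forall>K. compact K \<longrightarrow> emeasure \<mu> K < \<infinity>) \<and>
     (\<forall>A. A \<in> sets borel \<longrightarrow> emeasure \<mu> A = (INF U\<in>{U. open U \<and> A \<subseteq> U}. emeasure \<mu> U)) \<and>
     (\<forall>U. open U \<longrightarrow> emeasure \<mu> U = (SUP K\<in>{K. compact K \<and> K \<subseteq> U}. emeasure \<mu> K)) \<and>
     emeasure \<mu> UNIV \<noteq> 0"

definition is_subgroup :: "'g::group_add set \<Rightarrow> bool" where
  "is_subgroup H \<longleftrightarrow> 0 \<in> H \<and> (\<forall>x\<in>H. \<forall>y\<in>H. x + y \<in> H) \<and> (\<forall>x\<in>H. - x \<in> H)"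

definition discrete_subset :: "'g::topological_space set \<Rightarrow> bool" where
  "discrete_subset H \<longleftrightarrow> (\<forall>h\<in>H. \<exists>U. open U \<and> U \<inter> H = {h})"

definition amenable_discrete :: "'g::group_add set \<Rightarrow> bool" where
  "amenable_discrete H \<longleftrightarrow>
     (\<exists>m :: 'g set \<Rightarrow> real.
        m H = 1 \<and> (\<forall>A. A \<subseteq> H \<longrightarrow> 0 \<le> m A) \<and>
        (\<forall>A B. A \<subseteq> H \<longrightarrow> B \<subseteq> H \<longrightarrow> A \<inter> B = {} \<longrightarrow> m (A \<union> B) = m A + m B) \<and>
        (\<forall>h\<in>H. \<forall>A. A \<subseteq> H \<longrightarrow> m ((\<lambda>x. h + x) ` A) = m A))"

definition group_ring :: "'g set \<Rightarrow> ('g \<Rightarrow> complex) set" where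
  "group_ring H = {a. finite {h. a h \<noteq> 0} \<and> {h. a h \<noteq> 0} \<subseteq> H}"

definition gr_mult :: "('g::group_add \<Rightarrow> complex) \<Rightarrow> ('g \<Rightarrow> complex) \<Rightarrow> 'g \<Rightarrow> complex" where
  "gr_mult a b g = (\<Sum>h\<in>{h. a h \<noteq> 0}. a h * b (- h + g))"

definition non_zerodivisor :: "'g::group_add set \<Rightarrow> ('g \<Rightarrow> complex) \<Rightarrow> bool" where
  "non_zerodivisor H a \<longleftrightarrow>
     (\<forall>b\<in>group_ring H. b \<noteq> (\<lambda>_. 0) \<longrightarrow> gr_mult a b \<noteq> (\<lambda>_. 0) \<and> gr_mult b a \<noteq> (\<lambda>_. 0))"

text \<open>Square integrable complex functions (representatives of elements of L^2).\<close>
definition square_integrable :: "'g measure \<Rightarrow> ('g \<Rightarrow> complex) \<Rightarrow> bool" where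
  "square_integrable \<mu> f \<longleftrightarrow>
     f \<in> borel_measurable \<mu> \<and> (\<integral>\<^sup>+ x. ennreal ((cmod (f x))\<^sup>2) \<partial>\<mu>) < \<infinity>"

definition gr_act :: "('g::group_add \<Rightarrow> complex) \<Rightarrow> ('g \<Rightarrow> complex) \<Rightarrow> 'g \<Rightarrow> complex" where
  "gr_act a f x = (\<Sum>h\<in>{h. a h \<noteq> 0}. a h * f (- h + x))"

end

theory Submission
  imports Defs
begin

text \<open>Suppose \<open>\<alpha> * f = 0\<close>. For a Foelner set with small boundary, restrict the right translates of
  \<open>v h = f (h x)\<close> to it and form the square matrix of these restrictions. Its trace is
  \<open>f x\<close> times the cardinality. Its rank is at most the size of the boundary: \<open>\<alpha>\<close> maps the rows to
  functions supported on the boundary, and it is injective on finitely supported functions. The inequality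
  between trace, rank and Hilbert-Schmidt norm then bounds \<open>|f x|\<^sup>2\<close> by \<open>\<epsilon>\<close> times an average of
  sums of \<open>|f|\<^sup>2\<close> over finitely many points of the orbit \<open>H x\<close>. Integrating over an open set \<open>D\<close>
  whose \<open>H\<close>-translates are disjoint gives \<open>\<integral>\<^sub>D |f|\<^sup>2 \<le> \<epsilon> \<parallel>f\<parallel>\<^sup>2\<close>, so \<open>f\<close> vanishes
  almost everywhere on \<open>D\<close>; countably many such sets cover the group.\<close>

section \<open>Hall's theorem for infinite families of finite sets\<close>

text \<open>Rado's argument: a maximal set of deletable pairs leaves singletons, by submodularity of the
  cardinality.\<close>

lemma infinite_hall:
  fixes A :: "'i \<Rightarrow> 'b set"
  assumes fin: "\<And>i. i \<in> I \<Longrightarrow> finite (A i)"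
    and hall: "\<And>J. finite J \<Longrightarrow> J \<subseteq> I \<Longrightarrow> card J \<le> card (\<Union>i\<in>J. A i)"
  shows "\<exists>\<phi>. inj_on \<phi> I \<and> (\<forall>i\<in>I. \<phi> i \<in> A i)"
proof -
  \<comment> \<open>\<open>R\<close> collects deleted pairs \<open>(i, x)\<close>, and
    \<open>N R i\<close> is what the deletions leave of \<open>A i\<close>.\<close>
  define N where "N R i = A i - R `` {i}" for R :: "('i \<times> 'b) set" and i
  define \<R> where "\<R> = {R. R \<subseteq> Sigma I A \<and>
    (\<forall>J. finite J \<longrightarrow> J \<subseteq> I \<longrightarrow> card J \<le> card (\<Union>i\<in>J. N R i))}"
  have finN: "finite (\<Union>i\<in>J. N R i)" if "finite J" "J \<subseteq> I" for R J
    using that fin unfolding N_def by auto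
  have "{} \<in> \<R>" using hall by (auto simp: \<R>_def N_def)
  have "\<Union>\<C> \<in> \<R>" if "\<C> \<noteq> {}" and chain: "subset.chain \<R> \<C>" for \<C>
  proof -
    have sub: "\<C> \<subseteq> \<R>" using chain by (auto simp: subset.chain_def)
    have "card J \<le> card (\<Union>i\<in>J. N (\<Union>\<C>) i)" if J: "finite J" "J \<subseteq> I" for J
    proof -
      \<comment> \<open>Only the finitely many pairs over \<open>J\<close> affect Hall's condition
        for \<open>J\<close>, so one member of the chain already contains all relevant
        deletions.\<close>
      have "finite (\<Union>\<C> \<inter> Sigma J A)" using J fin by (intro finite_Int disjI2 finite_SigmaI) auto
      then obtain R where R: "R \<in> \<C>" "\<Union>\<C> \<inter> Sigma J A \<subseteq> R"
        by (rule finite_subset_Union_chain[OF _ Int_lower1 \<open>\<C> \<noteq> {}\<close> chain])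
      have "card J \<le> card (\<Union>i\<in>J. N R i)" using R sub J by (auto simp: \<R>_def)
      also have "\<dots> \<le> card (\<Union>i\<in>J. N (\<Union>\<C>) i)"
        using R by (intro card_mono finN J) (auto simp: N_def)
      finally show ?thesis .
    qed
    then show ?thesis using sub by (auto simp: \<R>_def)
  qed
  then obtain M where M: "M \<in> \<R>" and max: "\<And>X. X \<in> \<R> \<Longrightarrow> M \<subseteq> X \<Longrightarrow> X = M"
    using subset_Zorn_nonempty[of \<R>] \<open>{} \<in> \<R>\<close> by blast
  have hallM: "card J \<le> card (\<Union>i\<in>J. N M i)" if "finite J" "J \<subseteq> I" for J
    using M that by (auto simp: \<R>_def)
  \<comment> \<open>By maximality, deleting \<open>(i, x)\<close> breaks Hall's condition at some
    finite set, which must contain \<open>i\<close>. Here \<open>J\<close> is that set without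
    \<open>i\<close>, so the strict inequality becomes a weak one.\<close>
  have violation: "\<exists>J. finite J \<and> J \<subseteq> I \<and> i \<notin> J \<and> card ((\<Union>j\<in>J. N M j) \<union> (N M i - {x})) \<le> card J"
    if i: "i \<in> I" "x \<in> N M i" for i x
  proof -
    have "insert (i,x) M \<notin> \<R>" using max[of "insert (i,x) M"] i by (auto simp: N_def)
    moreover have "insert (i,x) M \<subseteq> Sigma I A" using M i by (auto simp: \<R>_def N_def)
    ultimately obtain J where J: "finite J" "J \<subseteq> I"
      "card (\<Union>j\<in>J. N (insert (i,x) M) j) < card J" by (auto simp: \<R>_def not_le)
    have "i \<in> J"
    proof (rule ccontr)
      assume "i \<notin> J"
      then have "(\<Union>j\<in>J. N (insert (i,x) M) j) = (\<Union>j\<in>J. N M j)" by (auto simp: N_def)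
      then show False using J(3) hallM[OF J(1,2)] by simp
    qed
    then have "(\<Union>j\<in>J. N (insert (i,x) M) j) = (\<Union>j\<in>J - {i}. N M j) \<union> (N M i - {x})"
      by (auto simp: N_def)
    moreover have "card J = Suc (card (J - {i}))" using \<open>i \<in> J\<close> J by (simp add: card_Suc_Diff1)
    ultimately show ?thesis using J by (intro exI[of _ "J - {i}"]) auto
  qed
  have unique: "x = y" if i: "i \<in> I" "x \<in> N M i" "y \<in> N M i" for i x y
  proof (rule ccontr)
    assume "x \<noteq> y"
    obtain J where J: "finite J" "J \<subseteq> I" "i \<notin> J"
      "card ((\<Union>j\<in>J. N M j) \<union> (N M i - {x})) \<le> card J" using violation[of i x] i by auto
    obtain K where K: "finite K" "K \<subseteq> I" "i \<notin> K"
      "card ((\<Union>j\<in>K. N M j) \<union> (N M i - {y})) \<le> card K" using violation[of i y] i by auto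
    \<comment> \<open>\<open>P \<union> Q\<close> recovers all of \<open>N M i\<close>, and
      \<open>P \<inter> Q\<close> contains the neighbours of \<open>J \<inter> K\<close>. Hall's
      condition for \<open>insert i (J \<union> K)\<close> and for \<open>J \<inter> K\<close> then
      forces \<open>card P + card Q\<close> above \<open>card J + card K\<close>.\<close>
    define P Q where "P = (\<Union>j\<in>J. N M j) \<union> (N M i - {x})" and "Q = (\<Union>j\<in>K. N M j) \<union> (N M i - {y})"
    have fPQ: "finite P" "finite Q"
      unfolding P_def Q_def using finN[OF J(1,2)] finN[OF K(1,2)] fin[OF i(1)] by (auto simp: N_def)
    have PQ: "P \<union> Q = (\<Union>j\<in>insert i (J \<union> K). N M j)" using \<open>x \<noteq> y\<close> i by (auto simp: P_def Q_def)
    have "card (insert i (J \<union> K)) \<le> card (P \<union> Q)" unfolding PQ using i J K by (intro hallM) auto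
    then have "Suc (card (J \<union> K)) \<le> card (P \<union> Q)" using J K by simp
    moreover have "card (J \<inter> K) \<le> card (\<Union>j\<in>J \<inter> K. N M j)" using J K by (intro hallM) auto
    moreover have "card (\<Union>j\<in>J \<inter> K. N M j) \<le> card (P \<inter> Q)"
      using fPQ by (intro card_mono) (auto simp: P_def Q_def)
    ultimately have "card J + card K + 1 \<le> card P + card Q"
      using card_Un_Int[OF fPQ] card_Un_Int[OF J(1) K(1)] by linarith
    then show False using J K by (simp add: P_def Q_def)
  qed
  have "\<exists>x. x \<in> N M i" if "i \<in> I" for i
    using hallM[of "{i}"] that by (cases "N M i = {}") auto
  then obtain \<phi> where \<phi>: "\<And>i. i \<in> I \<Longrightarrow> \<phi> i \<in> N M i" by metis
  have "i = j" if ij: "i \<in> I" "j \<in> I" "\<phi> i = \<phi> j" for i j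
  proof (rule ccontr)
    assume "i \<noteq> j"
    have "(\<Union>l\<in>{i,j}. N M l) \<subseteq> {\<phi> i}" using unique[OF ij(1) _ \<phi>[OF ij(1)]] unique[OF ij(2) _ \<phi>[OF ij(2)]] ij(3) by auto
    then have "card (\<Union>l\<in>{i,j}. N M l) \<le> 1" using card_mono[of "{\<phi> i}"] by simp
    then show False using hallM[of "{i,j}"] ij \<open>i \<noteq> j\<close> by simp
  qed
  then show ?thesis using \<phi> by (intro exI[of _ \<phi>]) (auto simp: inj_on_def N_def)
qed

section \<open>Foelner sets from an invariant mean\<close>

lemma finitely_additive_UN:
  fixes m :: "'a set \<Rightarrow> real"
  assumes add: "\<And>A B. A \<subseteq> H \<Longrightarrow> B \<subseteq> H \<Longrightarrow> A \<inter> B = {} \<Longrightarrow> m (A \<union> B) = m A + m B"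
    and "finite T" and "\<And>t. t \<in> T \<Longrightarrow> A t \<subseteq> H" and "disjoint_family_on A T"
  shows "m (\<Union>t\<in>T. A t) = (\<Sum>t\<in>T. m (A t))"
  using assms(2-)
proof (induction T rule: finite_induct)
  case empty
  then show ?case using add[of "{}" "{}"] by simp
next
  case (insert t T)
  have "m (A t \<union> (\<Union>s\<in>T. A s)) = m (A t) + m (\<Union>s\<in>T. A s)"
    using insert.hyps insert.prems by (intro add) (auto simp: disjoint_family_on_def)
  moreover have "m (\<Union>s\<in>T. A s) = (\<Sum>s\<in>T. m (A s))"
    using insert.prems by (intro insert.IH) (auto simp: disjoint_family_on_def)
  ultimately show ?case using insert.hyps by simp
qed

text \<open>If every finite set expanded by a fixed factor under \<open>K\<close>, a power of \<open>K\<close> would double every finite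
  set, and Hall's theorem would yield a paradoxical decomposition of \<open>H\<close>.\<close>

lemma amenable_folner:
  fixes H :: "'g::group_add set" and \<epsilon> :: real
  assumes H: "is_subgroup H" and am: "amenable_discrete H"
    and K: "finite K" "K \<subseteq> H" and "\<epsilon> > 0"
  shows "\<exists>F. finite F \<and> F \<noteq> {} \<and> F \<subseteq> H \<and> real (card (K + F)) \<le> (1 + \<epsilon>) * card F"
proof (rule ccontr)
  assume "\<not> ?thesis"
  \<comment> \<open>The weak inequality also covers \<open>F = {}\<close>, about which the negated
    claim says nothing.\<close>
  then have exp: "(1 + \<epsilon>) * card F \<le> card (K + F)" if "finite F" "F \<subseteq> H" for F
    using that by (cases "F = {}") (auto simp: not_le intro: less_imp_le)
  have plusH: "X + Y \<subseteq> H" if "X \<subseteq> H" "Y \<subseteq> H" for X Y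
    using that H by (auto simp: is_subgroup_def set_plus_def)
  have "\<exists>L. finite L \<and> L \<subseteq> H \<and> (\<forall>F. finite F \<longrightarrow> F \<subseteq> H \<longrightarrow> (1 + \<epsilon>) ^ n * card F \<le> card (L + F))" for n
  proof (induction n)
    case 0
    have "{0} + F = F" for F :: "'g set" by (auto simp: set_plus_def)
    then show ?case using H by (intro exI[of _ "{0}"]) (auto simp: is_subgroup_def)
  next
    case (Suc n)
    then obtain L where L: "finite L" "L \<subseteq> H"
      "\<And>F. finite F \<Longrightarrow> F \<subseteq> H \<Longrightarrow> (1 + \<epsilon>) ^ n * card F \<le> card (L + F)" by auto
    have "(1 + \<epsilon>) ^ Suc n * card F \<le> card ((K + L) + F)" if F: "finite F" "F \<subseteq> H" for F
    proof -
      have "(1 + \<epsilon>) ^ Suc n * card F \<le> (1 + \<epsilon>) * card (L + F)"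
        using L(3)[OF F] \<open>\<epsilon> > 0\<close> by (simp add: mult.assoc mult_left_mono)
      also have "\<dots> \<le> card (K + (L + F))"
        by (rule exp) (use L F plusH in \<open>auto intro: finite_set_plus\<close>)
      finally show ?thesis by (simp add: add.assoc)
    qed
    then show ?case using K L plusH by (intro exI[of _ "K + L"]) (auto intro: finite_set_plus)
  qed
  moreover obtain n where n: "2 < (1 + \<epsilon>) ^ n" using real_arch_pow[of "1 + \<epsilon>" 2] \<open>\<epsilon> > 0\<close> by auto
  ultimately obtain L where L: "finite L" "L \<subseteq> H"
    "\<And>F. finite F \<Longrightarrow> F \<subseteq> H \<Longrightarrow> (1 + \<epsilon>) ^ n * card F \<le> card (L + F)" by meson
  have dbl: "2 * card F \<le> card (L + F)" if "finite F" "F \<subseteq> H" for F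
  proof -
    have "2 * real (card F) \<le> (1 + \<epsilon>) ^ n * card F" using n by (intro mult_right_mono) auto
    then show ?thesis using L(3)[OF that] by linarith
  qed
  \<comment> \<open>The \<open>bool\<close> factor supplies two copies of \<open>H\<close>. An
    injective choice amounts to two injections of \<open>H\<close> into itself with disjoint images,
    each moving every point by a left factor from the finite set \<open>L\<close>.\<close>
  have "\<exists>\<phi>. inj_on \<phi> (H \<times> (UNIV :: bool set)) \<and> (\<forall>p\<in>H \<times> UNIV. \<phi> p \<in> (\<lambda>l. l + fst p) ` L)"
  proof (rule infinite_hall)
    fix J :: "('g \<times> bool) set" assume J: "finite J" "J \<subseteq> H \<times> UNIV"
    have "card J \<le> card (fst ` J \<times> (UNIV :: bool set))"
      using J by (intro card_mono) (auto intro: rev_image_eqI)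
    also have "\<dots> = 2 * card (fst ` J)" by (simp add: card_cartesian_product)
    also have "\<dots> \<le> card (L + fst ` J)" using J by (intro dbl) auto
    also have "L + fst ` J = (\<Union>p\<in>J. (\<lambda>l. l + fst p) ` L)" by (force simp: set_plus_def)
    finally show "card J \<le> card (\<Union>p\<in>J. (\<lambda>l. l + fst p) ` L)" .
  qed (use L in auto)
  then obtain \<phi> where inj: "inj_on \<phi> (H \<times> (UNIV :: bool set))"
    and \<phi>: "\<And>x i. x \<in> H \<Longrightarrow> \<phi> (x, i) \<in> (\<lambda>l. l + x) ` L" by auto
  obtain m :: "'g set \<Rightarrow> real" where m: "m H = 1" "\<forall>A. A \<subseteq> H \<longrightarrow> 0 \<le> m A"
    and add: "\<forall>A B. A \<subseteq> H \<longrightarrow> B \<subseteq> H \<longrightarrow> A \<inter> B = {} \<longrightarrow> m (A \<union> B) = m A + m B"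
    and inv: "\<forall>h\<in>H. \<forall>A. A \<subseteq> H \<longrightarrow> m ((\<lambda>x. h + x) ` A) = m A"
    using am unfolding amenable_discrete_def by (elim exE conjE) (rule that)
  \<comment> \<open>For fixed \<open>i\<close> the pieces \<open>P i l\<close> partition
    \<open>H\<close>, while their translates by \<open>l\<close> are pairwise disjoint over all
    pairs \<open>(i, l)\<close>. Invariance of the mean then gives
    \<open>2 \<le> m H\<close>.\<close>
  define P where "P i l = {x \<in> H. \<phi> (x, i) = l + x}" for i l
  have "(\<Sum>l\<in>L. m (P i l)) = 1" for i
  proof -
    have "(\<Union>l\<in>L. P i l) = H" using \<phi> by (fastforce simp: P_def)
    moreover have "disjoint_family_on (P i) L" by (auto simp: disjoint_family_on_def P_def)
    ultimately show ?thesis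
      using finitely_additive_UN[where A = "P i", OF add[rule_format] L(1)] m(1) by (auto simp: P_def)
  qed
  then have "2 = (\<Sum>(i, l)\<in>(UNIV :: bool set) \<times> L. m (P i l))"
    by (simp add: sum.cartesian_product[symmetric])
  also have "\<dots> = (\<Sum>(i, l)\<in>UNIV \<times> L. m ((\<lambda>x. l + x) ` P i l))"
    using L inv by (intro sum.cong) (auto simp: P_def)
  also have "\<dots> = m (\<Union>(i, l)\<in>UNIV \<times> L. (\<lambda>x. l + x) ` P i l)"
  proof -
    have "disjoint_family_on (\<lambda>(i, l). (\<lambda>x. l + x) ` P i l) (UNIV \<times> L)"
      unfolding disjoint_family_on_def
    proof (intro ballI impI)
      fix s t :: "bool \<times> 'g" assume "s \<noteq> t"
      have False if "x \<in> P (fst s) (snd s)" "y \<in> P (fst t) (snd t)" "snd s + x = snd t + y" for x y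
      proof -
        have "\<phi> (x, fst s) = \<phi> (y, fst t)" using that by (simp add: P_def)
        then have "(x, fst s) = (y, fst t)"
          by (rule inj_onD[OF inj]) (use that in \<open>auto simp: P_def\<close>)
        then show False using that \<open>s \<noteq> t\<close> by (auto simp: prod_eq_iff)
      qed
      then show "(case s of (i, l) \<Rightarrow> (\<lambda>x. l + x) ` P i l) \<inter> (case t of (i, l) \<Rightarrow> (\<lambda>x. l + x) ` P i l) = {}"
        unfolding case_prod_beta by blast
    qed
    moreover have "finite ((UNIV :: bool set) \<times> L)" using L by simp
    moreover have "(case t of (i, l) \<Rightarrow> (\<lambda>x. l + x) ` P i l) \<subseteq> H" if "t \<in> UNIV \<times> L" for t :: "bool \<times> 'g"
      using that L H by (auto simp: P_def is_subgroup_def)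
    ultimately show ?thesis
      using finitely_additive_UN[where T = "UNIV \<times> L" and A = "\<lambda>(i, l). (\<lambda>x. l + x) ` P i l",
          OF add[rule_format]]
      by (simp add: case_prod_beta)
  qed
  also have "\<dots> \<le> m H"
  proof -
    let ?U = "\<Union>(i, l)\<in>UNIV \<times> L. (\<lambda>x. l + x) ` P i l"
    have U: "?U \<subseteq> H" using L H by (auto simp: P_def is_subgroup_def subset_iff)
    have "m (?U \<union> (H - ?U)) = m ?U + m (H - ?U)" using U by (intro add[rule_format]) auto
    then show ?thesis using m(2)[rule_format, of "H - ?U"] U by (simp add: Un_absorb1)
  qed
  finally show False using m by simp
qed

section \<open>Trace, rank and Hilbert-Schmidt norm\<close>

text \<open>Gram-Schmidt by induction on the number of functionals: passing to the kernel of one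
  functional lowers the dimension by at most one. Orthonormality and spanning concern only the
  restrictions to \<open>F\<close>.\<close>

lemma orthonormal_spanning_family:
  fixes W :: "('g \<Rightarrow> complex) set" and \<Lambda> :: "'b \<Rightarrow> ('g \<Rightarrow> complex) \<Rightarrow> complex"
  assumes "finite B" and F: "finite F"
    and "\<And>w w' c. w \<in> W \<Longrightarrow> w' \<in> W \<Longrightarrow> (\<lambda>x. w x - c * w' x) \<in> W"
    and "\<And>b w w' c. b \<in> B \<Longrightarrow> \<Lambda> b (\<lambda>x. w x - c * w' x) = \<Lambda> b w - c * \<Lambda> b w'"
    and "\<And>w x. w \<in> W \<Longrightarrow> (\<forall>b\<in>B. \<Lambda> b w = 0) \<Longrightarrow> x \<in> F \<Longrightarrow> w x = 0"
  shows "\<exists>(r::nat) u. r \<le> card B \<and>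
    (\<forall>i<r. \<forall>j<r. (\<Sum>x\<in>F. u i x * cnj (u j x)) = (if i = j then 1 else 0)) \<and>
    (\<forall>w\<in>W. \<exists>c. \<forall>x\<in>F. w x = (\<Sum>i<r. c i * u i x))"
  using assms(1,3-)
proof (induction B arbitrary: W rule: finite_induct)
  case empty
  then show ?case by (intro exI[of _ 0]) auto
next
  case (insert b B)
  \<comment> \<open>On the kernel of \<open>\<Lambda> b\<close>, the vanishing of the functionals in
    \<open>B\<close> alone forces vanishing on \<open>F\<close>, so the induction hypothesis
    applies.\<close>
  define W' where "W' = {w \<in> W. \<Lambda> b w = 0}"
  have "\<exists>(r::nat) u. r \<le> card B \<and>
    (\<forall>i<r. \<forall>j<r. (\<Sum>x\<in>F. u i x * cnj (u j x)) = (if i = j then 1 else 0)) \<and>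
    (\<forall>w\<in>W'. \<exists>c. \<forall>x\<in>F. w x = (\<Sum>i<r. c i * u i x))"
    by (rule insert.IH) (use insert.prems in \<open>auto simp: W'_def\<close>)
  then obtain r :: nat and u where r: "r \<le> card B"
    and on': "\<forall>i<r. \<forall>j<r. (\<Sum>x\<in>F. u i x * cnj (u j x)) = (if i = j then 1 else 0)"
    and span': "\<forall>w\<in>W'. \<exists>c. \<forall>x\<in>F. w x = (\<Sum>i<r. c i * u i x)"
    by (elim exE conjE) (rule that)
  note on = on'[rule_format] and span = bspec[OF span']
  show ?case
  proof (cases "W' = W")
    case True
    then show ?thesis using r on span insert.hyps by (intro exI[of _ r] exI[of _ u]) auto
  next
    case False
    then obtain w0 where w0: "w0 \<in> W" "\<Lambda> b w0 \<noteq> 0" by (auto simp: W'_def)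
    define p where "p i = (\<Sum>x\<in>F. w0 x * cnj (u i x))" for i
    \<comment> \<open>The component of \<open>w0\<close> orthogonal on \<open>F\<close> to every
      \<open>u i\<close>: the next Gram-Schmidt vector before normalisation.\<close>
    define v where "v x = w0 x - (\<Sum>i<r. p i * u i x)" for x
    define n where "n = sqrt (\<Sum>x\<in>F. (cmod (v x))\<^sup>2)"
    have orth: "(\<Sum>x\<in>F. v x * cnj (u j x)) = 0" if "j < r" for j
    proof -
      have "(\<Sum>x\<in>F. v x * cnj (u j x)) = p j - (\<Sum>x\<in>F. \<Sum>i<r. p i * (u i x * cnj (u j x)))"
        by (simp add: v_def p_def left_diff_distrib sum_subtractf sum_distrib_right mult.assoc)
      also have "(\<Sum>x\<in>F. \<Sum>i<r. p i * (u i x * cnj (u j x))) = (\<Sum>i<r. p i * (if i = j then 1 else 0))"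
        using that by (subst sum.swap) (simp add: sum_distrib_left[symmetric] on)
      finally show ?thesis
        using that by (simp add: if_distrib[of "\<lambda>t. _ * t"] cong: if_cong)
    qed
    have orth': "(\<Sum>x\<in>F. u j x * cnj (v x)) = 0" if "j < r" for j
    proof -
      have "(\<Sum>x\<in>F. u j x * cnj (v x)) = cnj (\<Sum>x\<in>F. v x * cnj (u j x))" by (simp add: mult.commute)
      then show ?thesis using orth[OF that] by simp
    qed
    \<comment> \<open>Subtracting the multiple of \<open>w0\<close> with the same value under
      \<open>\<Lambda> b\<close> leads into \<open>W'\<close>, and \<open>w0\<close> itself is
      \<open>v\<close> plus a combination of the \<open>u i\<close>.\<close>
    have reduce: "\<exists>c d. \<forall>x\<in>F. w x = (\<Sum>i<r. c i * u i x) + d * v x" if "w \<in> W" for w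
    proof -
      define e where "e = \<Lambda> b w / \<Lambda> b w0"
      have "(\<lambda>x. w x - e * w0 x) \<in> W'"
        using w0 insert.prems(1)[OF that w0(1), of e] insert.prems(2)[of b w e w0]
        by (simp add: W'_def e_def)
      then obtain c where c: "\<forall>x\<in>F. w x - e * w0 x = (\<Sum>i<r. c i * u i x)" using span by blast
      have "w x = (\<Sum>i<r. (c i + e * p i) * u i x) + e * v x" if "x \<in> F" for x
        using c[rule_format, OF that]
        by (simp add: v_def algebra_simps sum.distrib sum_distrib_left)
      then show ?thesis by (intro exI[of _ "\<lambda>i. c i + e * p i"] exI[of _ e]) auto
    qed
    show ?thesis
    \<comment> \<open>If \<open>n = 0\<close>, then \<open>w0\<close> agrees on \<open>F\<close>
      with a combination of the \<open>u i\<close>, and the old family still suffices.\<close>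
    proof (cases "n = 0")
      case True
      then have "v x = 0" if "x \<in> F" for x
        using that F by (simp add: n_def sum_nonneg_eq_0_iff)
      then have "\<forall>w\<in>W. \<exists>c. \<forall>x\<in>F. w x = (\<Sum>i<r. c i * u i x)" using reduce by fastforce
      then show ?thesis using r on insert.hyps by (intro exI[of _ r] exI[of _ u]) auto
    next
      case False
      have vv: "(\<Sum>x\<in>F. v x * cnj (v x)) = (complex_of_real n)\<^sup>2"
        by (simp add: n_def complex_norm_square[symmetric] sum_nonneg flip: of_real_power of_real_sum)
      define u' where "u' i = (if i < r then u i else (\<lambda>x. v x / n))" for i
      have on': "(\<Sum>x\<in>F. u' i x * cnj (u' j x)) = (if i = j then 1 else 0)"
        if "i < Suc r" "j < Suc r" for i j
      proof -
        consider "i < r" "j < r" | "i < r" "j = r" | "i = r" "j < r" | "i = r" "j = r"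
          using \<open>i < Suc r\<close> \<open>j < Suc r\<close> by linarith
        then show ?thesis
        proof cases
          case 1
          then show ?thesis by (simp add: u'_def on)
        next
          case 2
          then show ?thesis using orth'[of i] by (simp add: u'_def sum_divide_distrib[symmetric])
        next
          case 3
          then show ?thesis using orth[of j] by (simp add: u'_def sum_divide_distrib[symmetric])
        next
          case 4
          then show ?thesis
            using vv False by (simp add: u'_def sum_divide_distrib[symmetric] power2_eq_square)
        qed
      qed
      have "\<exists>c. \<forall>x\<in>F. w x = (\<Sum>i<Suc r. c i * u' i x)" if "w \<in> W" for w
      proof -
        obtain c d where cd: "\<forall>x\<in>F. w x = (\<Sum>i<r. c i * u i x) + d * v x"
          using reduce[OF \<open>w \<in> W\<close>] by blast
        have "\<forall>x\<in>F. w x = (\<Sum>i<Suc r. (c(r := d * n)) i * u' i x)"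
          using cd False by (auto simp: u'_def)
        then show ?thesis by blast
      qed
      then show ?thesis
        using r on' insert.hyps by (intro exI[of _ "Suc r"] exI[of _ u']) auto
    qed
  qed
qed

text \<open>This is \<open>(tr M)\<^sup>2 \<le> rank M * (Hilbert-Schmidt norm of M)\<^sup>2\<close> for the matrix with rows \<open>w k\<close>, whose rank is
  at most \<open>card B\<close> since \<open>card B\<close> functionals separate the points of \<open>W\<close>.\<close>

lemma trace_bound:
  fixes W :: "('g \<Rightarrow> complex) set" and \<Lambda> :: "'b \<Rightarrow> ('g \<Rightarrow> complex) \<Rightarrow> complex"
  assumes B: "finite B" and F: "finite F"
    and W: "\<And>w w' c. w \<in> W \<Longrightarrow> w' \<in> W \<Longrightarrow> (\<lambda>x. w x - c * w' x) \<in> W"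
    and \<Lambda>: "\<And>b w w' c. b \<in> B \<Longrightarrow> \<Lambda> b (\<lambda>x. w x - c * w' x) = \<Lambda> b w - c * \<Lambda> b w'"
    and inj: "\<And>w x. w \<in> W \<Longrightarrow> (\<forall>b\<in>B. \<Lambda> b w = 0) \<Longrightarrow> x \<in> F \<Longrightarrow> w x = 0"
    and w: "\<And>k. k \<in> F \<Longrightarrow> w k \<in> W"
  shows "(cmod (\<Sum>k\<in>F. w k k))\<^sup>2 \<le> card B * (\<Sum>k\<in>F. \<Sum>x\<in>F. (cmod (w k x))\<^sup>2)"
proof -
  have spanning: "\<exists>(r::nat) u. r \<le> card B \<and>
    (\<forall>i<r. \<forall>j<r. (\<Sum>x\<in>F. u i x * cnj (u j x)) = (if i = j then 1 else 0)) \<and>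
    (\<forall>w\<in>W. \<exists>c. \<forall>x\<in>F. w x = (\<Sum>i<r. c i * u i x))"
    by (rule orthonormal_spanning_family[of B F W \<Lambda>]) (fact assms)+
  obtain r :: nat and u where r: "r \<le> card B"
    and on': "\<forall>i<r. \<forall>j<r. (\<Sum>x\<in>F. u i x * cnj (u j x)) = (if i = j then 1 else 0)"
    and span': "\<forall>w\<in>W. \<exists>c. \<forall>x\<in>F. w x = (\<Sum>i<r. c i * u i x)"
    using spanning
    by (elim exE conjE) (rule that)
  note on = on'[rule_format] and span = bspec[OF span']
  have "\<exists>c. \<forall>k\<in>F. \<forall>x\<in>F. w k x = (\<Sum>i<r. c k i * u i x)"
    using span[OF w] by (intro bchoice ballI) blast
  then obtain c where c: "\<And>k x. k \<in> F \<Longrightarrow> x \<in> F \<Longrightarrow> w k x = (\<Sum>i<r. c k i * u i x)" by blast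
  have norm_u: "(\<Sum>x\<in>F. (cmod (u i x))\<^sup>2) = 1" if "i < r" for i
  proof -
    have "complex_of_real (\<Sum>x\<in>F. (cmod (u i x))\<^sup>2) = 1"
      using on[OF that that] by (simp add: complex_norm_square del: of_real_power)
    then show ?thesis by (simp only: of_real_eq_1_iff)
  qed
  have parseval: "(\<Sum>x\<in>F. (cmod (w k x))\<^sup>2) = (\<Sum>i<r. (cmod (c k i))\<^sup>2)" if "k \<in> F" for k
  proof -
    have "complex_of_real (\<Sum>x\<in>F. (cmod (w k x))\<^sup>2) =
        (\<Sum>x\<in>F. (\<Sum>i<r. c k i * u i x) * cnj (\<Sum>j<r. c k j * u j x))"
      using that by (simp add: complex_norm_square c del: of_real_power)
    also have "\<dots> = (\<Sum>x\<in>F. \<Sum>i<r. \<Sum>j<r. c k i * cnj (c k j) * (u i x * cnj (u j x)))"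
      by (simp add: sum_product mult_ac)
    also have "\<dots> = (\<Sum>i<r. \<Sum>x\<in>F. \<Sum>j<r. c k i * cnj (c k j) * (u i x * cnj (u j x)))"
      by (rule sum.swap)
    also have "\<dots> = (\<Sum>i<r. \<Sum>j<r. \<Sum>x\<in>F. c k i * cnj (c k j) * (u i x * cnj (u j x)))"
      by (intro sum.cong refl sum.swap)
    also have "\<dots> = (\<Sum>i<r. \<Sum>j<r. c k i * cnj (c k j) * (if i = j then 1 else 0))"
      by (simp add: sum_distrib_left[symmetric] on)
    also have "\<dots> = complex_of_real (\<Sum>i<r. (cmod (c k i))\<^sup>2)"
      by (simp add: complex_norm_square if_distrib[of "\<lambda>t. _ * t"] del: of_real_power cong: if_cong)
    finally show ?thesis by (simp only: of_real_eq_iff)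
  qed
  have "cmod (\<Sum>k\<in>F. w k k) \<le> (\<Sum>k\<in>F. \<Sum>i<r. cmod (c k i) * cmod (u i k))"
    by (simp add: c norm_mult[symmetric] cong: sum.cong)
       (intro order.trans[OF norm_sum] sum_mono norm_sum)
  also have "\<dots> = (\<Sum>(k, i)\<in>F \<times> {..<r}. cmod (c k i) * cmod (u i k))"
    by (rule sum.cartesian_product)
  \<comment> \<open>Cauchy-Schwarz over all pairs \<open>(k, i)\<close> at once: the coefficients
    contribute the Hilbert-Schmidt norm by \<open>parseval\<close>, and the \<open>r\<close> unit
    vectors contribute \<open>r\<close>.\<close>
  finally have "(cmod (\<Sum>k\<in>F. w k k))\<^sup>2 \<le> (\<Sum>p\<in>F \<times> {..<r}. cmod (c (fst p) (snd p)) * cmod (u (snd p) (fst p)))\<^sup>2"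
    by (intro power_mono) (auto simp: case_prod_beta)
  also have "\<dots> \<le> (\<Sum>p\<in>F \<times> {..<r}. (cmod (c (fst p) (snd p)))\<^sup>2) * (\<Sum>p\<in>F \<times> {..<r}. (cmod (u (snd p) (fst p)))\<^sup>2)"
    by (rule Cauchy_Schwarz_ineq_sum)
  also have "(\<Sum>p\<in>F \<times> {..<r}. (cmod (c (fst p) (snd p)))\<^sup>2) = (\<Sum>k\<in>F. \<Sum>x\<in>F. (cmod (w k x))\<^sup>2)"
    using sum.cartesian_product[of "\<lambda>k i. (cmod (c k i))\<^sup>2" "{..<r}" F]
    by (simp add: parseval case_prod_beta)
  also have "(\<Sum>p\<in>F \<times> {..<r}. (cmod (u (snd p) (fst p)))\<^sup>2) = r"
    using sum.cartesian_product[of "\<lambda>k i. (cmod (u i k))\<^sup>2" "{..<r}" F]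
      sum.swap[of "\<lambda>k i. (cmod (u i k))\<^sup>2" "{..<r}" F]
    by (simp add: norm_u case_prod_beta)
  also have "(\<Sum>k\<in>F. \<Sum>x\<in>F. (cmod (w k x))\<^sup>2) * r \<le> (\<Sum>k\<in>F. \<Sum>x\<in>F. (cmod (w k x))\<^sup>2) * card B"
    using r by (intro mult_left_mono sum_nonneg) auto
  finally show ?thesis by (simp add: mult.commute)
qed

section \<open>The pointwise bound along one orbit\<close>

text \<open>The right translates of \<open>v\<close> by \<open>k \<in> E\<close>, cut off to \<open>E\<close>, are annihilated by \<open>a\<close> outside the boundary \<open>B\<close>.\<close>

lemma folner_pointwise_bound:
  fixes H :: "'g::group_add set" and a v :: "'g \<Rightarrow> complex"
  assumes H: "is_subgroup H" and a: "a \<in> group_ring H"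
    and inj: "\<And>b. b \<in> group_ring H \<Longrightarrow> gr_mult a b = (\<lambda>_. 0) \<Longrightarrow> b = (\<lambda>_. 0)"
    and S: "S = {h. a h \<noteq> 0}" and F: "finite F" "F \<subseteq> H"
    and E: "E = uminus ` S + F" and B: "B = (S + E) - F"
    and v: "\<And>z k. z \<in> F \<Longrightarrow> k \<in> E \<Longrightarrow> gr_act a v (z - k) = 0"
  shows "(real (card E) * cmod (v 0))\<^sup>2 \<le> card B * (\<Sum>k\<in>E. \<Sum>y\<in>E. (cmod (v (y - k)))\<^sup>2)"
proof -
  have finS: "finite S" and SH: "S \<subseteq> H" using a by (auto simp: S group_ring_def)
  have finE: "finite E" unfolding E using finS F by (intro finite_set_plus finite_imageI)
  have EH: "E \<subseteq> H" unfolding E using H SH F by (auto simp: is_subgroup_def set_plus_def)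
  have finB: "finite B" unfolding B using finS finE by (intro finite_Diff finite_set_plus)
  \<comment> \<open>For \<open>w\<close> in \<open>W\<close>, the product \<open>gr_mult a w\<close>
    lives on \<open>S + E\<close> and vanishes on \<open>F\<close>. Its values on \<open>B\<close>
    therefore determine it and, by \<open>inj\<close>, also \<open>w\<close>; evaluations at the
    points of \<open>B\<close> serve as the functionals.\<close>
  define W where "W = {w. (\<forall>x. x \<notin> E \<longrightarrow> w x = 0) \<and> (\<forall>z\<in>F. gr_mult a w z = 0)}"
  define w where "w k x = (if x \<in> E then v (x - k) else 0)" for k x
  have lin: "gr_mult a (\<lambda>x. w x - c * w' x) z = gr_mult a w z - c * gr_mult a w' z" for w w' c z
    by (simp add: gr_mult_def sum_subtractf sum_distrib_left algebra_simps)
  have "(cmod (\<Sum>k\<in>E. w k k))\<^sup>2 \<le> card B * (\<Sum>k\<in>E. \<Sum>x\<in>E. (cmod (w k x))\<^sup>2)"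
  proof (rule trace_bound[where W = W and \<Lambda> = "\<lambda>z w. gr_mult a w z"])
    show "(\<lambda>x. w x - c * w' x) \<in> W" if "w \<in> W" "w' \<in> W" for w w' c
      using that by (simp add: W_def lin)
  next
    fix w x assume w: "w \<in> W" and z: "\<forall>z\<in>B. gr_mult a w z = 0"
    have "{h. w h \<noteq> 0} \<subseteq> E" using w by (auto simp: W_def)
    then have "w \<in> group_ring H" using finE EH by (auto simp: group_ring_def intro: finite_subset)
    moreover have "gr_mult a w z = 0" for z
    proof (cases "z \<in> S + E")
      case True
      then show ?thesis using w z by (cases "z \<in> F") (auto simp: W_def B)
    next
      case False
      have "w (- h + z) = 0" if "h \<in> S" for h
      proof -
        have "z = h + (- h + z)" by (simp add: add.assoc[symmetric])
        then have "- h + z \<notin> E" using False that by (metis set_plus_intro)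
        then show ?thesis using w by (simp add: W_def)
      qed
      then show ?thesis by (simp add: gr_mult_def S)
    qed
    ultimately show "w x = 0" using inj[of w] by (auto simp: fun_eq_iff)
  next
    fix k assume k: "k \<in> E"
    have "gr_mult a (w k) z = 0" if z: "z \<in> F" for z
    proof -
      \<comment> \<open>\<open>E\<close> contains every point that enters the product at a point of
        \<open>F\<close>, so the cut-off to \<open>E\<close> is invisible there.\<close>
      have "- h + z \<in> E" if "h \<in> S" for h using that z unfolding E by auto
      then have "gr_mult a (w k) z = gr_act a v (z - k)"
        unfolding gr_mult_def gr_act_def
        by (intro sum.cong) (auto simp: w_def S[symmetric] add_diff_eq)
      then show ?thesis using v z k by simp
    qed
    then show "w k \<in> W" by (simp add: W_def w_def)
  qed (use finB finE in \<open>auto simp: lin\<close>)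
  \<comment> \<open>Every diagonal entry is \<open>v (k - k)\<close>; this is what the right
    translates are for.\<close>
  moreover have "(\<Sum>k\<in>E. w k k) = card E * v 0" by (simp add: w_def)
  ultimately show ?thesis by (simp add: w_def norm_mult)
qed

section \<open>Left translation, and vanishing of kernel elements on small sets\<close>

text \<open>Invariance in the form needed for substitution in integrals and for moving null sets:
  the preimage under translation by \<open>g\<close> is the image under translation by
  \<open>- g\<close>.\<close>

lemma left_haar_distr:
  fixes \<mu> :: "'g::{group_add, t2_space} measure"
  assumes G: "topological_group_type TYPE('g)" and \<mu>: "left_haar_measure \<mu>"
  shows "(\<lambda>x. g + x) \<in> measurable \<mu> \<mu>" and "distr \<mu> \<mu> (\<lambda>x. g + x) = \<mu>"
proof -
  have sets: "sets \<mu> = sets borel" and sp: "space \<mu> = UNIV"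
    and inv: "\<And>g A. A \<in> sets borel \<Longrightarrow> emeasure \<mu> ((\<lambda>x. g + x) ` A) = emeasure \<mu> A"
    using \<mu> by (auto simp: left_haar_measure_def)
  have "continuous_on UNIV (\<lambda>x::'g. g + x)"
    using continuous_on_compose2[of UNIV "\<lambda>p::'g \<times> 'g. fst p + snd p" UNIV "\<lambda>x. (g, x)",
        OF _ continuous_on_Pair[OF continuous_on_const continuous_on_id]] G
    by (simp add: topological_group_type_def)
  then show meas: "(\<lambda>x. g + x) \<in> measurable \<mu> \<mu>"
    using borel_measurable_continuous_onI by (simp add: measurable_def sets sp) blast
  show "distr \<mu> \<mu> (\<lambda>x. g + x) = \<mu>"
  proof (rule measure_eqI)
    fix A assume "A \<in> sets (distr \<mu> \<mu> (\<lambda>x. g + x))"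
    then have A: "A \<in> sets \<mu>" by simp
    have "(\<lambda>x. g + x) -` A = (\<lambda>x. - g + x) ` A"
      by (auto simp: image_iff add.assoc[symmetric] intro!: bexI[of _ "g + _"])
    then show "emeasure (distr \<mu> \<mu> (\<lambda>x. g + x)) A = emeasure \<mu> A"
      using A inv[of A "- g"] by (simp add: emeasure_distr meas sp sets)
  qed simp
qed

lemma AE_left_translate:
  fixes \<mu> :: "'g::{group_add, t2_space} measure"
  assumes "topological_group_type TYPE('g)" and "left_haar_measure \<mu>" and "AE x in \<mu>. P x"
  shows "AE x in \<mu>. P (g + x)"
  by (rule AE_distrD[OF left_haar_distr(1)[OF assms(1,2)]])
     (simp only: left_haar_distr(2)[OF assms(1,2)] assms(3))

text \<open>For fixed \<open>k\<close>, left invariance turns the integrals over \<open>D\<close> of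
  the translates by \<open>y - k\<close> into integrals over disjoint translates of
  \<open>D\<close>. Each \<open>k\<close> thus costs at most the full square norm, and the resulting
  factor \<open>card E\<close> cancels.\<close>

lemma kernel_vanishes_on_disjoint_translates:
  fixes \<mu> :: "'g::{group_add, t2_space} measure" and f :: "'g \<Rightarrow> complex"
  assumes G: "topological_group_type TYPE('g)" and \<mu>: "left_haar_measure \<mu>"
    and H: "is_subgroup H" and am: "amenable_discrete H"
    and a: "a \<in> group_ring H" and nz: "non_zerodivisor H a"
    and f: "square_integrable \<mu> f" and ker: "AE x in \<mu>. gr_act a f x = 0"
    and D: "D \<in> sets \<mu>"
    and disj: "\<And>h k z. h \<in> H \<Longrightarrow> k \<in> H \<Longrightarrow> - h + z \<in> D \<Longrightarrow> - k + z \<in> D \<Longrightarrow> h = k"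
  shows "AE x in \<mu>. x \<in> D \<longrightarrow> f x = 0"
proof -
  define S where "S = {h. a h \<noteq> 0}"
  define q where "q x = ennreal ((cmod (f x))\<^sup>2)" for x
  note trans [measurable] = left_haar_distr(1)[OF G \<mu>]
  have fm [measurable]: "f \<in> borel_measurable \<mu>" and fin: "(\<integral>\<^sup>+ x. q x \<partial>\<mu>) < \<infinity>"
    using f by (auto simp: square_integrable_def q_def)
  have q [measurable]: "q \<in> borel_measurable \<mu>" unfolding q_def by measurable
  note D [measurable]
  have finS: "finite S" and SH: "S \<subseteq> H" using a by (auto simp: S_def group_ring_def)
  have inj: "b = (\<lambda>_. 0)" if "b \<in> group_ring H" "gr_mult a b = (\<lambda>_. 0)" for b
    using nz that by (auto simp: non_zerodivisor_def)
  \<comment> \<open>The zero element is a zerodivisor, as the unit of the group ring shows.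
    Nonemptiness of \<open>S\<close> makes \<open>E\<close> at least as large as
    \<open>F\<close>.\<close>
  have "S \<noteq> {}"
  proof
    assume "S = {}"
    let ?b = "\<lambda>x::'g. if x = 0 then 1 else 0 :: complex"
    have "?b \<in> group_ring H" using H by (auto simp: group_ring_def is_subgroup_def)
    moreover have "gr_mult a ?b = (\<lambda>_. 0)" using \<open>S = {}\<close> by (simp add: gr_mult_def S_def fun_eq_iff)
    ultimately show False using fun_cong[OF inj[of ?b], of 0] by simp
  qed
  have small: "(\<integral>\<^sup>+ x. q x * indicator D x \<partial>\<mu>) \<le> ennreal \<epsilon> * (\<integral>\<^sup>+ x. q x \<partial>\<mu>)" if "\<epsilon> > 0" for \<epsilon> :: real
  proof -
    \<comment> \<open>\<open>S + E\<close> is \<open>F\<close> expanded by this set of differences,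
      so its Foelner sets are the right ones: as \<open>F\<close> lies in \<open>S + E\<close>, the
      excess counted by the Foelner condition is exactly \<open>B\<close>.\<close>
    have KH: "S + uminus ` S \<subseteq> H"
    proof
      fix t assume "t \<in> S + uminus ` S"
      then obtain p r where "t = p + - r" "p \<in> S" "r \<in> S" by (auto elim!: set_plus_elim)
      then show "t \<in> H" using SH H unfolding is_subgroup_def by blast
    qed
    have "\<exists>F. finite F \<and> F \<noteq> {} \<and> F \<subseteq> H \<and> real (card ((S + uminus ` S) + F)) \<le> (1 + \<epsilon>) * card F"
      by (rule amenable_folner[OF H am _ KH \<open>\<epsilon> > 0\<close>])
         (use finS in \<open>auto intro!: finite_set_plus\<close>)
    then obtain F where F: "finite F" "F \<noteq> {}" "F \<subseteq> H"
      and folner: "real (card ((S + uminus ` S) + F)) \<le> (1 + \<epsilon>) * card F" by blast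
    define E where "E = uminus ` S + F"
    define B where "B = (S + E) - F"
    have finE: "finite E" unfolding E_def using finS F by (intro finite_set_plus finite_imageI)
    have EH: "E \<subseteq> H" unfolding E_def using H SH F by (auto simp: is_subgroup_def set_plus_def)
    obtain s where s: "s \<in> S" using \<open>S \<noteq> {}\<close> by blast
    have "card F = card ((\<lambda>z. - s + z) ` F)" by (simp add: card_image)
    also have "\<dots> \<le> card E" using finE s by (intro card_mono) (auto simp: E_def)
    finally have FE: "card F \<le> card E" .
    then have Epos: "card E > 0" using F by (metis card_gt_0_iff less_le_trans)
    have FSE: "F \<subseteq> S + E"
    proof
      fix z assume "z \<in> F"
      then have "s + (- s + z) \<in> S + E" using s by (intro set_plus_intro) (auto simp: E_def)
      then show "z \<in> S + E" by (simp add: add.assoc[symmetric])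
    qed
    have "real (card B) = real (card (S + E)) - card F"
      unfolding B_def using F FSE finS finE
      by (simp add: card_Diff_subset of_nat_diff card_mono finite_set_plus)
    also have "\<dots> \<le> \<epsilon> * card F" using folner by (simp add: E_def add.assoc algebra_simps)
    also have "\<dots> \<le> \<epsilon> * card E" using FE \<open>\<epsilon> > 0\<close> by (intro mult_left_mono) auto
    finally have cardB: "real (card B) \<le> \<epsilon> * card E" .
    \<comment> \<open>Finitely many translates of one null set are discarded. At each remaining
      \<open>x\<close> the pointwise bound applies to \<open>v h = f (h + x)\<close>, with
      \<open>0 + x\<close> below displaying \<open>v 0\<close>.\<close>
    have "AE x in \<mu>. \<forall>z\<in>F. \<forall>k\<in>E. gr_act a f ((z - k) + x) = 0"
      using F finE AE_left_translate[OF G \<mu> ker] by (simp add: AE_finite_all)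
    then have "AE x in \<mu>. card E * q x \<le> \<epsilon> * (\<Sum>k\<in>E. \<Sum>y\<in>E. q ((y - k) + x))"
    proof eventually_elim
      case (elim x)
      have "(real (card E) * cmod (f (0 + x)))\<^sup>2 \<le> card B * (\<Sum>k\<in>E. \<Sum>y\<in>E. (cmod (f ((y - k) + x)))\<^sup>2)"
        by (rule folner_pointwise_bound[OF H a inj S_def F(1,3) E_def B_def])
           (use elim in \<open>auto simp: gr_act_def add.assoc diff_conv_add_uminus simp del: add_uminus_conv_diff\<close>)
      also have "\<dots> \<le> \<epsilon> * card E * (\<Sum>k\<in>E. \<Sum>y\<in>E. (cmod (f ((y - k) + x)))\<^sup>2)"
        using cardB by (intro mult_right_mono sum_nonneg) auto
      finally have "card E * (card E * (cmod (f x))\<^sup>2) \<le> card E * (\<epsilon> * (\<Sum>k\<in>E. \<Sum>y\<in>E. (cmod (f ((y - k) + x)))\<^sup>2))"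
        by (simp add: power2_eq_square mult_ac)
      then have "card E * (cmod (f x))\<^sup>2 \<le> \<epsilon> * (\<Sum>k\<in>E. \<Sum>y\<in>E. (cmod (f ((y - k) + x)))\<^sup>2)"
        using Epos by simp
      then have "ennreal (card E * (cmod (f x))\<^sup>2) \<le> ennreal (\<epsilon> * (\<Sum>k\<in>E. \<Sum>y\<in>E. (cmod (f ((y - k) + x)))\<^sup>2))"
        by (rule ennreal_leI)
      then show ?case
        using \<open>\<epsilon> > 0\<close> by (simp add: q_def ennreal_mult ennreal_of_nat_eq_real_of_nat sum_nonneg flip: sum_ennreal)
    qed
    then have "(\<integral>\<^sup>+ x. (card E * q x) * indicator D x \<partial>\<mu>)
      \<le> (\<integral>\<^sup>+ x. (\<epsilon> * (\<Sum>k\<in>E. \<Sum>y\<in>E. q ((y - k) + x))) * indicator D x \<partial>\<mu>)"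
      by (intro nn_integral_mono_AE) (auto elim!: eventually_mono intro: mult_right_mono)
    also have "\<dots> = \<epsilon> * (\<Sum>k\<in>E. \<Sum>y\<in>E. \<integral>\<^sup>+ x. q ((y - k) + x) * indicator D x \<partial>\<mu>)"
      by (simp add: mult.assoc nn_integral_cmult sum_distrib_right nn_integral_sum)
    also have "\<dots> \<le> \<epsilon> * (\<Sum>k\<in>E. \<integral>\<^sup>+ x. q x \<partial>\<mu>)"
    proof (intro mult_left_mono sum_mono)
      fix k assume k: "k \<in> E"
      have "(\<Sum>y\<in>E. \<integral>\<^sup>+ x. q ((y - k) + x) * indicator D x \<partial>\<mu>)
        = (\<Sum>y\<in>E. \<integral>\<^sup>+ z. q z * indicator D (- (y - k) + z) \<partial>\<mu>)"
      proof (intro sum.cong refl)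
        fix y
        have "(\<integral>\<^sup>+ z. q z * indicator D (- (y - k) + z) \<partial>\<mu>)
          = (\<integral>\<^sup>+ z. q z * indicator D (- (y - k) + z) \<partial>(distr \<mu> \<mu> (\<lambda>x. (y - k) + x)))"
          by (simp only: left_haar_distr(2)[OF G \<mu>])
        also have "\<dots> = (\<integral>\<^sup>+ x. q ((y - k) + x) * indicator D (- (y - k) + ((y - k) + x)) \<partial>\<mu>)"
          by (rule nn_integral_distr) measurable
        finally show "(\<integral>\<^sup>+ x. q ((y - k) + x) * indicator D x \<partial>\<mu>)
          = (\<integral>\<^sup>+ z. q z * indicator D (- (y - k) + z) \<partial>\<mu>)" by (simp only: minus_add_cancel)
      qed
      also have "\<dots> = (\<integral>\<^sup>+ z. (\<Sum>y\<in>E. q z * indicator D (- (y - k) + z)) \<partial>\<mu>)"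
        by (rule nn_integral_sum[symmetric]) measurable
      also have "\<dots> \<le> (\<integral>\<^sup>+ z. q z \<partial>\<mu>)"
      proof (rule nn_integral_mono)
        fix z
        \<comment> \<open>Each \<open>z\<close> lies in at most one of the translates of
          \<open>D\<close>, since \<open>y - k\<close> determines \<open>y\<close>.\<close>
        have "card {y \<in> E. - (y - k) + z \<in> D} \<le> 1"
        proof -
          have "y = y'" if "y \<in> E" "y' \<in> E" "- (y - k) + z \<in> D" "- (y' - k) + z \<in> D" for y y'
          proof -
            have "y - k \<in> H" "y' - k \<in> H"
              using that k EH H unfolding is_subgroup_def diff_conv_add_uminus by blast+
            then have "y - k = y' - k" using disj that by blast
            then have "y - k + k = y' - k + k" by (rule arg_cong)
            then show ?thesis by (simp only: diff_add_cancel)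
          qed
          then show ?thesis using finE by (auto simp: card_le_Suc0_iff_eq)
        qed
        then have "of_nat (card {y \<in> E. - (y - k) + z \<in> D}) * q z \<le> of_nat 1 * q z"
          by (intro mult_right_mono of_nat_mono) auto
        moreover have "(\<Sum>y\<in>E. q z * indicator D (- (y - k) + z))
          = (\<Sum>y\<in>E. if - (y - k) + z \<in> D then q z else 0)"
          by (intro sum.cong) (auto simp: indicator_def)
        moreover have "\<dots> = (\<Sum>y | y \<in> E \<and> - (y - k) + z \<in> D. q z)"
          using finE by (rule sum.inter_filter[symmetric])
        ultimately show "(\<Sum>y\<in>E. q z * indicator D (- (y - k) + z)) \<le> q z"
          by (simp only: sum_constant of_nat_1 mult_1)
      qed
      finally show "(\<Sum>y\<in>E. \<integral>\<^sup>+ x. q ((y - k) + x) * indicator D x \<partial>\<mu>) \<le> (\<integral>\<^sup>+ x. q x \<partial>\<mu>)" .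
    qed simp
    also have "\<dots> = card E * (\<epsilon> * (\<integral>\<^sup>+ x. q x \<partial>\<mu>))" by (simp add: mult_ac)
    finally have "card E * (\<integral>\<^sup>+ x. q x * indicator D x \<partial>\<mu>) \<le> card E * (\<epsilon> * (\<integral>\<^sup>+ x. q x \<partial>\<mu>))"
      by (simp add: mult.assoc nn_integral_cmult)
    then show ?thesis using Epos by (simp add: ennreal_mult_le_mult_iff)
  qed
  have "(\<integral>\<^sup>+ x. q x * indicator D x \<partial>\<mu>) = 0"
  proof -
    obtain r where r: "(\<integral>\<^sup>+ x. q x \<partial>\<mu>) = ennreal r" "r \<ge> 0" using fin by (cases "\<integral>\<^sup>+ x. q x \<partial>\<mu>") auto
    have "(\<integral>\<^sup>+ x. q x * indicator D x \<partial>\<mu>) \<le> 0 + ennreal e" if "e > 0" for e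
    proof -
      \<comment> \<open>The bound \<open>small\<close> is used with \<open>e / (r + 1)\<close>; the
        added 1 keeps the quotient defined as intended when \<open>r = 0\<close>.\<close>
      have "e / (r + 1) * r \<le> e" using \<open>e > 0\<close> r by (simp add: field_simps)
      then have "ennreal (e / (r + 1)) * ennreal r \<le> ennreal e"
        using r \<open>e > 0\<close> by (simp add: ennreal_mult[symmetric] ennreal_leI)
      then show ?thesis using small[of "e / (r + 1)"] r \<open>e > 0\<close> by (auto intro: order_trans)
    qed
    then have "(\<integral>\<^sup>+ x. q x * indicator D x \<partial>\<mu>) \<le> 0" by (rule ennreal_le_epsilon)
    then show ?thesis by simp
  qed
  then have "AE x in \<mu>. q x * indicator D x = 0" by (simp add: nn_integral_0_iff_AE)
  then show ?thesis by eventually_elim (auto simp: q_def indicator_def split: if_splits)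
qed

section \<open>Disjoint translates and the covering argument\<close>

text \<open>In \<open>(- h + z) - (- k + z)\<close> the point \<open>z\<close> cancels, leaving
  \<open>- h + k\<close> in \<open>H\<close>. Continuity of the difference at \<open>(g, g)\<close>
  puts it into a neighbourhood that meets \<open>H\<close> only in 0.\<close>

lemma discrete_subgroup_disjoint_neighbourhood:
  fixes H :: "'g::{group_add, topological_space} set"
  assumes G: "topological_group_type TYPE('g)"
    and H: "is_subgroup H" and dH: "discrete_subset H"
  shows "\<exists>D. open D \<and> g \<in> D \<and> (\<forall>h\<in>H. \<forall>k\<in>H. \<forall>z. - h + z \<in> D \<longrightarrow> - k + z \<in> D \<longrightarrow> h = k)"
proof -
  have cp: "continuous_on UNIV (\<lambda>p::'g \<times> 'g. fst p + snd p)" and cm: "continuous_on UNIV (\<lambda>x::'g. - x)"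
    using G by (auto simp: topological_group_type_def)
  have cd: "continuous_on UNIV (\<lambda>p::'g \<times> 'g. fst p - snd p)"
  proof -
    have "continuous_on UNIV (\<lambda>p::'g \<times> 'g. - snd p)"
      by (rule continuous_on_compose2[OF cm continuous_on_snd[OF continuous_on_id]]) simp
    then have "continuous_on UNIV (\<lambda>p::'g \<times> 'g. (fst p, - snd p))"
      by (intro continuous_on_Pair continuous_on_fst continuous_on_id)
    from continuous_on_compose2[OF cp this] show ?thesis by simp
  qed
  obtain U where U: "open U" "U \<inter> H = {0}"
    using H dH by (auto simp: discrete_subset_def is_subgroup_def)
  have "open ((\<lambda>p::'g \<times> 'g. fst p - snd p) -` U)"
    using cd U by (simp add: continuous_on_open_vimage)
  moreover have "(g, g) \<in> (\<lambda>p. fst p - snd p) -` U" using U by auto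
  ultimately obtain D1 D2 where D: "open D1" "open D2" "g \<in> D1" "g \<in> D2"
    and sub: "D1 \<times> D2 \<subseteq> (\<lambda>p. fst p - snd p) -` U"
    by (auto elim!: open_prod_elim)
  have "h = k" if "h \<in> H" "k \<in> H" "- h + z \<in> D1 \<inter> D2" "- k + z \<in> D1 \<inter> D2" for h k z
  proof -
    have "(- h + z) - (- k + z) \<in> U" using sub that by auto
    moreover have "(- h + z) - (- k + z) = - h + k" by (simp add: algebra_simps)
    moreover have "- h + k \<in> H" using that H by (auto simp: is_subgroup_def)
    ultimately have "- h + k = 0" using U by auto
    then show ?thesis by (metis add.inverse_inverse minus_unique)
  qed
  then show ?thesis using D by (intro exI[of _ "D1 \<inter> D2"]) auto
qed

theorem theorem5p4:
  fixes \<mu> :: "'g::{group_add, t2_space} measure"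
    and H :: "'g set"
    and a :: "'g \<Rightarrow> complex"
    and f :: "'g \<Rightarrow> complex"
  assumes "topological_group_type TYPE('g)"
    and "locally_compact_type TYPE('g)"
    and "sigma_compact_type TYPE('g)"
    and "left_haar_measure \<mu>"
    and "is_subgroup H" and "discrete_subset H" and "amenable_discrete H"
    and "a \<in> group_ring H" and "non_zerodivisor H a"
    and "square_integrable \<mu> f" and "\<not> (AE x in \<mu>. f x = 0)"
  shows "\<not> (AE x in \<mu>. gr_act a f x = 0)"
proof
  assume ker: "AE x in \<mu>. gr_act a f x = 0"
  have sets: "sets \<mu> = sets borel" using \<open>left_haar_measure \<mu>\<close> by (simp add: left_haar_measure_def)
  have "\<exists>D. open D \<and> g \<in> D \<and> (AE x in \<mu>. x \<in> D \<longrightarrow> f x = 0)" for g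
  proof -
    obtain D where D: "open D" "g \<in> D"
      and disj: "\<forall>h\<in>H. \<forall>k\<in>H. \<forall>z. - h + z \<in> D \<longrightarrow> - k + z \<in> D \<longrightarrow> h = k"
      using discrete_subgroup_disjoint_neighbourhood[of H g] assms by blast
    have "AE x in \<mu>. x \<in> D \<longrightarrow> f x = 0"
      by (rule kernel_vanishes_on_disjoint_translates[of \<mu> H a f])
         (use assms ker D sets disj in auto)
    then show ?thesis using D by blast
  qed
  then obtain D where D: "\<And>g. open (D g)" "\<And>g. g \<in> D g" "\<And>g. AE x in \<mu>. x \<in> D g \<longrightarrow> f x = 0"
    by metis
  \<comment> \<open>The \<open>D g\<close> form a possibly uncountable cover. Sigma-compactness
    reduces it to finitely many sets for each \<open>K n\<close>, so only countably many null sets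
    have to be united.\<close>
  obtain K :: "nat \<Rightarrow> 'g set" where K: "\<And>n. compact (K n)" "(\<Union>n. K n) = UNIV"
    using \<open>sigma_compact_type TYPE('g)\<close> by (auto simp: sigma_compact_type_def)
  have "AE x in \<mu>. x \<in> K n \<longrightarrow> f x = 0" for n
  proof -
    obtain T where T: "finite T" "K n \<subseteq> (\<Union>g\<in>T. D g)"
      by (rule compactE_image[OF K(1), of UNIV D n]) (use D(1,2) in blast)+
    have "AE x in \<mu>. \<forall>g\<in>T. x \<in> D g \<longrightarrow> f x = 0" by (rule AE_finite_allI[OF T(1) D(3)])
    then show ?thesis by eventually_elim (use T in auto)
  qed
  then have "AE x in \<mu>. \<forall>n. x \<in> K n \<longrightarrow> f x = 0" unfolding AE_all_countable by blast
  then have "AE x in \<mu>. f x = 0" by eventually_elim (use K(2) in auto)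
  then show False using assms by simp
qed

end
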